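(* Let $1\le p<\infty$ with conjugate exponent $q$ ($1/p+1/q=1$), let $\{\beta(n)\}_{n\ge 0}$ be a sequence of positive numbers with $\beta(0)=1$, let $d\in\mathbb{N}_0$, $\alpha_0,\dots,\alpha_d\in\mathbb{R}$ and $\varphi(z)=\sum_{m=0}^{d}\alpha_m z^m$. For $n,L\in\mathbb{N}_0$ put $$\theta_{n,L}:=\sum_{(l_0,\dots,l_d)\in N(n,L)}\frac{L!\,\alpha_0^{l_0}\alpha_1^{l_1}\cdots\alpha_d^{l_d}}{l_0!\cdots l_d!},$$ where $$N(n,L):=\Big\{(l_0,\dots,l_d): l_i\in\mathbb{N}_0,\ \sum_{i=0}^{d}l_i=L,\ \sum_{i=1}^{d} i\,l_i=n\Big\},$$ and put $$B_d=\sum_{n=0}^{\infty}\left[\sum_{L\in\mathbb{N}_0}\left(\frac{|\theta_{n,L}|\,\beta(n)}{\beta(L)}\right)^{q}\right]^{p/q}.$$ Then the following hold. (a) If $B_d<\infty$, then the composition operator $C_\varphi f=f\circ\varphi$ is a bounded operator on $\ell^p(\beta)$ and $\|C_\varphi\|\le B_d^{1/p}$. (b) If $C_\varphi$ is a bounded operator on $\ell^p(\beta)$, then $$M:=\sup_{n\ge 0}\frac{\left(\sum_{L\in\mathbb{N}_0}|\theta_{L,n}|^{p}\beta(L)^p\right)^{1/p}}{\beta(n)}<\infty,$$ and $M\le\|C_\varphi\|$.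
   Context: $\mathbb{N}_0=\{0,1,2,\dots\}$; $0^0=1$. $\ell^{p}(\beta)$ is the space of formal power series $f(z)=\sum_{n\ge 0}\hat f(n)z^{n}$ with complex coefficients such that $\|f\|_\beta^p=\sum_{n\ge 0}|\hat f(n)|^p\beta(n)^p<\infty$, with norm $\|\cdot\|_\beta$. For a polynomial $\varphi$, $f\circ\varphi=\sum_{L\ge0}\hat f(L)\varphi^L$ is the formal power series whose $n$-th coefficient is $\sum_{L\ge 0}\hat f(L)c_{n,L}$, where $c_{n,L}$ is the coefficient of $z^n$ in $\varphi(z)^L$ (these series are required to converge). $C_\varphi$ is bounded on $\ell^p(\beta)$ if $f\circ\varphi$ is defined and lies in $\ell^p(\beta)$ for every $f\in\ell^p(\beta)$ and $C_\varphi$ is bounded for $\|\cdot\|_\beta$; $\|C_\varphi\|$ is the operator norm. If $p=1$ then $q=\infty$, and $[\sum_L(x_L)^q]^{p/q}$ means $(\sup_L x_L)^p$. Standing assumption: if $\lim_n\beta(n+1)/\beta(n)=1$ or $\liminf_n\beta(n)^{1/n}=1$, then $\varphi(\mathbb{D})\subseteq\mathbb{D}$, where $\mathbb{D}$ is the open unit disc of $\mathbb{C}$. *)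

theory Defs
  imports "HOL-Analysis.Analysis"
begin

definition lp_space :: "real \<Rightarrow> (nat \<Rightarrow> real) \<Rightarrow> complex fps set" where
  "lp_space p \<beta> = {f. summable (\<lambda>n. cmod (fps_nth f n) powr p * \<beta> n powr p)}"

definition lp_norm :: "real \<Rightarrow> (nat \<Rightarrow> real) \<Rightarrow> complex fps \<Rightarrow> real" where
  "lp_norm p \<beta> f = (\<Sum>n. cmod (fps_nth f n) powr p * \<beta> n powr p) powr (1 / p)"

(* fps_compose only models composition with a series that has zero constant term.
   Here the constant term is arbitrary, so every coefficient of the composition is an
   infinite series of complex numbers, whose convergence is a separate requirement. *)
definition fps_poly_composable :: "complex fps \<Rightarrow> complex poly \<Rightarrow> bool" where
  "fps_poly_composable f \<phi> \<longleftrightarrow> (\<forall>n. summable (\<lambda>L. fps_nth f L * coeff (\<phi> ^ L) n))"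

definition fps_poly_compose :: "complex fps \<Rightarrow> complex poly \<Rightarrow> complex fps" where
  "fps_poly_compose f \<phi> = Abs_fps (\<lambda>n. \<Sum>L. fps_nth f L * coeff (\<phi> ^ L) n)"

definition comp_op_bounded :: "real \<Rightarrow> (nat \<Rightarrow> real) \<Rightarrow> complex poly \<Rightarrow> bool" where
  "comp_op_bounded p \<beta> \<phi> \<longleftrightarrow>
     (\<forall>f\<in>lp_space p \<beta>. fps_poly_composable f \<phi> \<and> fps_poly_compose f \<phi> \<in> lp_space p \<beta>) \<and>
     (\<exists>K. \<forall>f\<in>lp_space p \<beta>. lp_norm p \<beta> (fps_poly_compose f \<phi>) \<le> K * lp_norm p \<beta> f)"

(* Meaningful only if comp_op_bounded p \<beta> \<phi> holds; otherwise the set may be unbounded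
   and its real supremum is unspecified. *)
definition comp_op_norm :: "real \<Rightarrow> (nat \<Rightarrow> real) \<Rightarrow> complex poly \<Rightarrow> real" where
  "comp_op_norm p \<beta> \<phi> =
     Sup {lp_norm p \<beta> (fps_poly_compose f \<phi>) | f. f \<in> lp_space p \<beta> \<and> lp_norm p \<beta> f \<le> 1}"

definition symbol_poly :: "nat \<Rightarrow> (nat \<Rightarrow> real) \<Rightarrow> complex poly" where
  "symbol_poly d \<alpha> = (\<Sum>m\<le>d. monom (complex_of_real (\<alpha> m)) m)"

(* A tuple (l_0, ..., l_d) is a function on {..d}, extended by undefined outside. *)
definition exponent_tuples :: "nat \<Rightarrow> nat \<Rightarrow> nat \<Rightarrow> (nat \<Rightarrow> nat) set" where
  "exponent_tuples d n L =
     {l \<in> {..d} \<rightarrow>\<^sub>E UNIV. (\<Sum>i\<le>d. l i) = L \<and> (\<Sum>i=1..d. i * l i) = n}"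

definition theta :: "nat \<Rightarrow> (nat \<Rightarrow> real) \<Rightarrow> nat \<Rightarrow> nat \<Rightarrow> real" where
  "theta d \<alpha> n L =
     (\<Sum>l\<in>exponent_tuples d n L. fact L * (\<Prod>i\<le>d. \<alpha> i ^ l i) / (\<Prod>i\<le>d. fact (l i)))"

(* Powers in [0, \<infinity>]; used only with exponents a > 0. *)
definition ennpowr :: "ennreal \<Rightarrow> real \<Rightarrow> ennreal" where
  "ennpowr x a = (if x = \<infinity> then \<infinity> else ennreal (enn2real x powr a))"

(* The quantity [sum_L (x_L)^q]^(p/q), read as (sup_L x_L)^p for q = \<infinity>. *)
definition lq_sum_powr :: "real \<Rightarrow> ennreal \<Rightarrow> (nat \<Rightarrow> real) \<Rightarrow> ennreal" where
  "lq_sum_powr p q x =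
     (if q = \<infinity> then ennpowr (SUP L. ennreal (x L)) p
      else ennpowr (\<Sum>L. ennreal (x L powr enn2real q)) (p / enn2real q))"

definition B_sum :: "nat \<Rightarrow> (nat \<Rightarrow> real) \<Rightarrow> (nat \<Rightarrow> real) \<Rightarrow> real \<Rightarrow> ennreal \<Rightarrow> ennreal" where
  "B_sum d \<alpha> \<beta> p q = (\<Sum>n. lq_sum_powr p q (\<lambda>L. \<bar>theta d \<alpha> n L\<bar> * \<beta> n / \<beta> L))"

definition M_sup :: "nat \<Rightarrow> (nat \<Rightarrow> real) \<Rightarrow> (nat \<Rightarrow> real) \<Rightarrow> real \<Rightarrow> ennreal" where
  "M_sup d \<alpha> \<beta> p =
     (SUP n. ennpowr (\<Sum>L. ennreal (\<bar>theta d \<alpha> L n\<bar> powr p * \<beta> L powr p)) (1 / p)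
               / ennreal (\<beta> n))"

end

theory Submission
  imports Defs
begin

text \<open>
  By the multinomial theorem, \<open>theta d \<alpha> n L\<close> is the coefficient of \<open>z\<^sup>n\<close> in \<open>\<phi>\<^sup>L\<close>
  (\<open>coeff_symbol_poly_power\<close>), so the numbers \<open>theta d \<alpha> n L\<close> are the entries of the matrix of
  \<open>C\<^sub>\<phi>\<close> with respect to the monomials. Both halves of the theorem then become standard estimates for
  an infinite matrix acting on a weighted sequence space: a bound on the rows is sufficient for
  boundedness, and a bound on the columns is necessary.

  For the upper bound, the \<open>n\<close>-th coefficient of \<open>f \<circ> \<phi>\<close>, multiplied by \<open>\<beta> n\<close>, is the pairing of
  the sequence \<open>L \<mapsto> f\<^sub>L \<beta> L\<close>, which lies in \<open>\<ell>\<^sup>p\<close>, with the \<open>n\<close>-th row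
  \<open>L \<mapsto> theta d \<alpha> n L * \<beta> n / \<beta> L\<close>. Hoelder's inequality (\<open>holder_lq_sum_powr\<close>) shows that the
  pairing converges and that the \<open>p\<close>-th power of its modulus is at most \<open>\<parallel>f\<parallel>\<^sup>p\<close> times the
  \<open>p\<close>-th power of the \<open>\<ell>\<^sup>q\<close> norm of the row. Summing over \<open>n\<close> gives
  \<open>\<parallel>f \<circ> \<phi>\<parallel>\<^sup>p \<le> B \<parallel>f\<parallel>\<^sup>p\<close> (\<open>lp_norm_fps_poly_compose_le\<close>).

  For the lower bound, \<open>C\<^sub>\<phi>\<close> is tested on the normalised monomials \<open>z\<^sup>n / \<beta> n\<close>: such a monomial has
  norm one and its image is the \<open>n\<close>-th column divided by \<open>\<beta> n\<close>, whose norm is the \<open>n\<close>-th term of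
  the supremum \<open>M\<close>.
\<close>

section \<open>Coefficients of the powers of the symbol\<close>

lemma finite_exponent_tuples: "finite (exponent_tuples d n L)"
proof (rule finite_subset)
  show "exponent_tuples d n L \<subseteq> {..d} \<rightarrow>\<^sub>E {..L}"
  proof
    fix l assume l: "l \<in> exponent_tuples d n L"
    have "l i \<le> L" if "i \<le> d" for i
    proof -
      have "l i \<le> (\<Sum>i\<le>d. l i)" using that by (intro member_le_sum) auto
      thus ?thesis using l by (simp add: exponent_tuples_def)
    qed
    thus "l \<in> {..d} \<rightarrow>\<^sub>E {..L}" using l by (auto simp: exponent_tuples_def PiE_iff)
  qed
  show "finite ({..d} \<rightarrow>\<^sub>E {..L})" by (intro finite_PiE) auto
qed

text \<open>Splitting off the last exponent \<open>k\<close> is what drives the induction on \<open>d\<close> in the multinomial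
  theorem. The conditions on \<open>k\<close> make both natural-number differences exact. The inverse map resets
  the last entry to \<open>undefined\<close>, the value of a shorter tuple there.\<close>

lemma bij_betw_exponent_tuples_Suc:
  "bij_betw (\<lambda>(k, l). l(Suc d := k))
     (SIGMA k:{k. k \<le> L \<and> Suc d * k \<le> n}. exponent_tuples d (n - Suc d * k) (L - k))
     (exponent_tuples (Suc d) n L)"
proof (rule bij_betw_byWitness[where f' = "\<lambda>l. (l (Suc d), l(Suc d := undefined))"])
  have *: "(\<Sum>i=1..d. i * (l(Suc d := k)) i) = (\<Sum>i=1..d. i * l i)"
      "(\<Sum>i\<le>d. (l(Suc d := k)) i) = (\<Sum>i\<le>d. l i)" for l :: "nat \<Rightarrow> nat" and k
    by (intro sum.cong; simp)+
  show "\<forall>a\<in>SIGMA k:{k. k \<le> L \<and> Suc d * k \<le> n}. exponent_tuples d (n - Suc d * k) (L - k).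
          (\<lambda>l. (l (Suc d), l(Suc d := undefined))) (case a of (k, l) \<Rightarrow> l(Suc d := k)) = a"
    by (auto simp: exponent_tuples_def PiE_iff extensional_def fun_eq_iff)
  show "\<forall>a'\<in>exponent_tuples (Suc d) n L.
          (case (a' (Suc d), a'(Suc d := undefined)) of (k, l) \<Rightarrow> l(Suc d := k)) = a'"
    by auto
  show "(\<lambda>(k, l). l(Suc d := k)) `
          (SIGMA k:{k. k \<le> L \<and> Suc d * k \<le> n}. exponent_tuples d (n - Suc d * k) (L - k))
        \<subseteq> exponent_tuples (Suc d) n L"
    by (auto simp: exponent_tuples_def PiE_iff extensional_def * simp del: fun_upd_apply)
       auto
  show "(\<lambda>l. (l (Suc d), l(Suc d := undefined))) ` exponent_tuples (Suc d) n L
        \<subseteq> (SIGMA k:{k. k \<le> L \<and> Suc d * k \<le> n}. exponent_tuples d (n - Suc d * k) (L - k))"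
    by (auto simp: exponent_tuples_def PiE_iff extensional_def * simp del: fun_upd_apply mult_Suc)
      auto
qed

text \<open>By induction on \<open>d\<close>, expanding with the binomial theorem around the last monomial: its \<open>k\<close>-th
  power shifts the coefficients of the remaining factor by \<open>Suc d * k\<close>, and the binomial coefficient
  \<open>L choose k\<close> turns multinomial coefficients of total \<open>L - k\<close> into those of total \<open>L\<close>.\<close>

lemma coeff_sum_monom_power:
  fixes c :: "nat \<Rightarrow> 'a :: field_char_0"
  shows "coeff ((\<Sum>m\<le>d. monom (c m) m) ^ L) n =
    (\<Sum>l\<in>exponent_tuples d n L. fact L * (\<Prod>i\<le>d. c i ^ l i) / (\<Prod>i\<le>d. fact (l i)))"
proof (induction d arbitrary: n L)
  case 0
  have "exponent_tuples 0 n L = (if n = 0 then {(\<lambda>_. undefined)(0 := L)} else {})"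
    by (auto simp: exponent_tuples_def PiE_iff extensional_def fun_eq_iff)
  thus ?case by (simp add: monom_power)
next
  case (Suc d)
  let ?P = "\<Sum>m\<le>d. monom (c m) m"
  let ?K = "{k. k \<le> L \<and> Suc d * k \<le> n}"
  let ?w = "\<lambda>d L l. fact L * (\<Prod>i\<le>d. c i ^ l i) / (\<Prod>i\<le>d. fact (l i)) :: 'a"
  have "coeff ((\<Sum>m\<le>Suc d. monom (c m) m) ^ L) n =
      coeff ((monom (c (Suc d)) (Suc d) + ?P) ^ L) n"
    by (simp add: add.commute)
  also have "\<dots> = (\<Sum>k\<le>L. coeff (of_nat (L choose k) * monom (c (Suc d) ^ k) (Suc d * k) * ?P ^ (L - k)) n)"
    by (simp add: binomial_ring coeff_sum monom_power del: mult_Suc)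
  also have "\<dots> = (\<Sum>k\<le>L. if Suc d * k \<le> n then
       of_nat (L choose k) * c (Suc d) ^ k * coeff (?P ^ (L - k)) (n - Suc d * k) else 0)"
    by (intro sum.cong refl)
       (auto simp: of_nat_poly mult.assoc coeff_monom_mult simp del: mult_Suc)
  also have "\<dots> = (\<Sum>k\<in>?K.
       of_nat (L choose k) * c (Suc d) ^ k * coeff (?P ^ (L - k)) (n - Suc d * k))"
    by (intro sum.mono_neutral_cong_right) auto
  also have "\<dots> = (\<Sum>k\<in>?K. \<Sum>l\<in>exponent_tuples d (n - Suc d * k) (L - k).
       of_nat (L choose k) * c (Suc d) ^ k * ?w d (L - k) l)"
    by (simp add: Suc.IH sum_distrib_left del: mult_Suc)
  also have "\<dots> = (\<Sum>k\<in>?K. \<Sum>l\<in>exponent_tuples d (n - Suc d * k) (L - k).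
       ?w (Suc d) L (l(Suc d := k)))"
  proof (intro sum.cong refl)
    fix k l assume k: "k \<in> ?K"
    have "(\<Prod>i\<le>d. c i ^ (l(Suc d := k)) i) = (\<Prod>i\<le>d. c i ^ l i)"
         "(\<Prod>i\<le>d. fact ((l(Suc d := k)) i)) = (\<Prod>i\<le>d. fact (l i) :: 'a)"
      by (intro prod.cong; simp)+
    thus "of_nat (L choose k) * c (Suc d) ^ k * ?w d (L - k) l = ?w (Suc d) L (l(Suc d := k))"
      using k by (simp add: binomial_fact mult_ac)
  qed
  also have "\<dots> = (\<Sum>(k, l)\<in>(SIGMA k:?K. exponent_tuples d (n - Suc d * k) (L - k)).
       ?w (Suc d) L (l(Suc d := k)))"
    by (rule sum.Sigma) (auto simp: finite_exponent_tuples)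
  also have "\<dots> = (\<Sum>l\<in>exponent_tuples (Suc d) n L. ?w (Suc d) L l)"
    using sum.reindex_bij_betw[OF bij_betw_exponent_tuples_Suc[of d L n], of "?w (Suc d) L"]
    by (simp add: case_prod_beta' del: mult_Suc prod.atMost_Suc)
  finally show ?case .
qed

lemma coeff_symbol_poly_power:
  "coeff (symbol_poly d \<alpha> ^ L) n = complex_of_real (theta d \<alpha> n L)"
  unfolding symbol_poly_def coeff_sum_monom_power theta_def by simp

section \<open>Hoelder's inequality for series\<close>

text \<open>Scaled to norm one, the two sequences satisfy Young's inequality termwise, which gives
  convergence by comparison and the estimate by summation. If one of the norms vanishes, so does
  every product.\<close>

lemma holder_series:
  fixes a x :: "nat \<Rightarrow> real"
  assumes pq: "p > 1" "q > 1" "1 / p + 1 / q = 1"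
    and nonneg: "\<And>n. 0 \<le> a n" "\<And>n. 0 \<le> x n"
    and a: "summable (\<lambda>n. a n powr p)" and x: "summable (\<lambda>n. x n powr q)"
  shows "summable (\<lambda>n. a n * x n)" (is ?summable)
    and "(\<Sum>n. a n * x n) \<le> (\<Sum>n. a n powr p) powr (1 / p) * (\<Sum>n. x n powr q) powr (1 / q)"
      (is ?le)
proof -
  define A where "A = (\<Sum>n. a n powr p)"
  define X where "X = (\<Sum>n. x n powr q)"
  have "A \<ge> 0" "X \<ge> 0" using a x by (auto simp: A_def X_def intro: suminf_nonneg)
  have "?summable \<and> ?le"
  proof (cases "A = 0 \<or> X = 0")
    case True
    hence "a n * x n = 0" for n
      using suminf_eq_zero_iff[OF a] suminf_eq_zero_iff[OF x] by (auto simp: A_def X_def)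
    hence "(\<lambda>n. a n * x n) = (\<lambda>_. 0)" by blast
    thus ?thesis by simp
  next
    case False
    with \<open>A \<ge> 0\<close> \<open>X \<ge> 0\<close> have pos: "A > 0" "X > 0" by auto
    define s where "s = A powr (1 / p)"
    define t where "t = X powr (1 / q)"
    have st: "s > 0" "t > 0" "s powr p = A" "t powr q = X"
      using pos pq by (simp_all add: s_def t_def powr_powr)
    (* Young's majorant for a n / s and x n / t, scaled back; its sum is s * t (1 / p + 1 / q) *)
    define y where "y = (\<lambda>n. s * t * (a n powr p / A / p + x n powr q / X / q))"
    have y: "a n * x n \<le> y n" for n
    proof -
      have "a n / s * (x n / t) \<le> (a n / s) powr p / p + (x n / t) powr q / q"
        using nonneg st pq by (intro Youngs_inequality) auto
      also have "\<dots> = a n powr p / A / p + x n powr q / X / q"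
        using nonneg st by (simp add: powr_divide)
      finally show ?thesis using st by (simp add: y_def field_simps)
    qed
    have "(\<lambda>n. a n powr p) sums A" "(\<lambda>n. x n powr q) sums X"
      using a x by (simp_all add: A_def X_def summable_sums)
    hence "y sums (s * t * (A / A / p + X / X / q))"
      unfolding y_def by (intro sums_mult sums_add sums_divide)
    hence y_sums: "y sums (s * t)" using pos pq by simp
    have sm: "summable (\<lambda>n. a n * x n)"
      using y nonneg by (intro summable_comparison_test'[OF sums_summable[OF y_sums], of 0]) auto
    moreover have "(\<Sum>n. a n * x n) \<le> s * t"
      using suminf_le[OF y sm sums_summable[OF y_sums]] sums_unique[OF y_sums] by simp
    ultimately show ?thesis by (simp add: s_def t_def A_def X_def)
  qed
  thus ?summable ?le by auto
qed

lemma ennreal_conjugate_exponent_cases: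
  assumes p: "1 \<le> p" and conj: "1 / ennreal p + 1 / q = 1"
  obtains "p = 1" "q = \<infinity>"
  | r where "p > 1" "r > 1" "q = ennreal r" "1 / p + 1 / r = 1"
proof (cases q)
  case top
  hence "1 / ennreal p = 1" using conj by simp
  hence "ennreal (1 / p) = ennreal 1" using p by (simp add: divide_ennreal[symmetric] flip: ennreal_1)
  hence "p = 1" using p by (subst (asm) ennreal_inj) auto
  thus ?thesis using top that(1) by simp
next
  case (real r)
  have "r \<noteq> 0" using conj real by (auto simp: ennreal_divide_zero)
  hence r: "r > 0" using real by simp
  have "ennreal (1 / p + 1 / r) = ennreal 1"
    using conj real p r by (simp add: divide_ennreal[symmetric] ennreal_plus flip: ennreal_1)
  hence eq: "1 / p + 1 / r = 1" using p r by (subst (asm) ennreal_inj) auto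
  have "1 / r > 0" using r by simp
  hence "1 / p < 1" using eq by linarith
  hence "p > 1" using p by (simp add: field_simps)
  hence "1 / p > 0" by simp
  hence "1 / r < 1" using eq by linarith
  hence "r > 1" using r by (simp add: field_simps)
  thus ?thesis using that(2) real eq \<open>p > 1\<close> by simp
qed

text \<open>Hoelder's inequality raised to the power \<open>p\<close>, the form in which it bounds a single
  coefficient of a composition. For \<open>p = 1\<close> it is the trivial estimate by the supremum of \<open>x\<close>; finiteness
  of \<open>lq_sum_powr p q x\<close> expresses that \<open>x\<close> lies in \<open>\<ell>\<^sup>q\<close>.\<close>

lemma holder_lq_sum_powr:
  fixes a x :: "nat \<Rightarrow> real"
  assumes p: "1 \<le> p" and conj: "1 / ennreal p + 1 / q = 1"
    and nonneg: "\<And>n. 0 \<le> a n" "\<And>n. 0 \<le> x n"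
    and a: "summable (\<lambda>n. a n powr p)" and fin: "lq_sum_powr p q x < \<infinity>"
  shows "summable (\<lambda>n. a n * x n)" (is ?summable)
    and "(\<Sum>n. a n * x n) powr p \<le> (\<Sum>n. a n powr p) * enn2real (lq_sum_powr p q x)" (is ?le)
proof -
  from p conj have "?summable \<and> ?le"
  proof (cases rule: ennreal_conjugate_exponent_cases)
    case 1
    define S where "S = (SUP n. ennreal (x n))"
    have lq_S: "lq_sum_powr p q x = ennpowr S p"
      unfolding lq_sum_powr_def S_def using 1 by simp
    have S: "S \<noteq> \<infinity>"
    proof
      assume "S = \<infinity>"
      thus False using fin unfolding lq_S ennpowr_def by simp
    qed
    have lq: "enn2real (lq_sum_powr p q x) = enn2real S"
      unfolding lq_S ennpowr_def using 1 S by simp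
    have xS: "x n \<le> enn2real S" for n
    proof -
      have "ennreal (x n) \<le> S" unfolding S_def by (rule SUP_upper) simp
      thus ?thesis using S nonneg(2)[of n] enn2real_mono[of "ennreal (x n)" S]
        by (simp add: top.not_eq_extremum)
    qed
    have a1: "summable a" using a 1 nonneg by simp
    have le: "a n * x n \<le> a n * enn2real S" for n
      using xS nonneg by (intro mult_left_mono)
    have sm: "summable (\<lambda>n. a n * x n)"
      using le nonneg
      by (intro summable_comparison_test'[OF summable_mult2[OF a1, of "enn2real S"], of 0]) auto
    have "(\<Sum>n. a n * x n) \<le> (\<Sum>n. a n) * enn2real S"
      using suminf_le[OF le sm summable_mult2[OF a1]] suminf_mult2[OF a1] by simp
    moreover have "(\<Sum>n. a n * x n) \<ge> 0" using sm nonneg by (intro suminf_nonneg) auto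
    ultimately show ?thesis using sm 1 nonneg lq by simp
  next
    case (2 r)
    have "(\<Sum>n. ennreal (x n powr r)) \<noteq> \<infinity>"
      using fin 2 by (auto simp: lq_sum_powr_def ennpowr_def)
    hence x: "summable (\<lambda>n. x n powr r)"
      by (intro summable_suminf_not_top) auto
    have lq: "enn2real (lq_sum_powr p q x) = (\<Sum>n. x n powr r) powr (p / r)"
      using 2 x by (simp add: lq_sum_powr_def ennpowr_def suminf_ennreal2 suminf_nonneg)
    note holder = holder_series[OF \<open>p > 1\<close> \<open>r > 1\<close> \<open>1 / p + 1 / r = 1\<close> nonneg a x]
    have "(\<Sum>n. a n * x n) powr p \<le>
        ((\<Sum>n. a n powr p) powr (1 / p) * (\<Sum>n. x n powr r) powr (1 / r)) powr p"
      using p holder nonneg by (intro powr_mono2 suminf_nonneg) auto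
    also have "\<dots> = (\<Sum>n. a n powr p) * (\<Sum>n. x n powr r) powr (p / r)"
      using p a by (simp add: powr_mult powr_powr suminf_nonneg)
    finally show ?thesis using holder(1) lq by simp
  qed
  thus ?summable ?le by auto
qed

section \<open>Norms and operator norms\<close>

lemma zero_in_lp_space: "0 \<in> lp_space p \<beta>"
  by (simp add: lp_space_def)

lemma lp_norm_zero: "lp_norm p \<beta> 0 = 0"
  by (simp add: lp_norm_def)

lemma lp_norm_nonneg: "0 \<le> lp_norm p \<beta> f"
  by (simp add: lp_norm_def)

text \<open>Boundedness of the operator enters because a real supremum is an upper bound only of a set that
  is bounded above.\<close>

lemma lp_norm_compose_le_comp_op_norm:
  assumes "comp_op_bounded p \<beta> \<phi>" "f \<in> lp_space p \<beta>" "lp_norm p \<beta> f \<le> 1"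
  shows "lp_norm p \<beta> (fps_poly_compose f \<phi>) \<le> comp_op_norm p \<beta> \<phi>"
  unfolding comp_op_norm_def
proof (rule cSup_upper)
  obtain K where K: "\<And>f. f \<in> lp_space p \<beta> \<Longrightarrow>
      lp_norm p \<beta> (fps_poly_compose f \<phi>) \<le> K * lp_norm p \<beta> f"
    using assms(1) unfolding comp_op_bounded_def by blast
  show "bdd_above {lp_norm p \<beta> (fps_poly_compose f \<phi>) | f. f \<in> lp_space p \<beta> \<and> lp_norm p \<beta> f \<le> 1}"
  proof (rule bdd_aboveI[where M = "\<bar>K\<bar>"], safe)
    fix f assume f: "f \<in> lp_space p \<beta>" "lp_norm p \<beta> f \<le> 1"
    have "lp_norm p \<beta> (fps_poly_compose f \<phi>) \<le> K * lp_norm p \<beta> f" by (rule K[OF f(1)])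
    also have "\<dots> \<le> \<bar>K\<bar> * 1"
      using f(2) lp_norm_nonneg[of p \<beta> f] by (intro mult_mono) auto
    finally show "lp_norm p \<beta> (fps_poly_compose f \<phi>) \<le> \<bar>K\<bar>" by simp
  qed
qed (use assms in blast)

lemma comp_op_norm_le:
  assumes "\<And>f. f \<in> lp_space p \<beta> \<Longrightarrow> lp_norm p \<beta> (fps_poly_compose f \<phi>) \<le> K * lp_norm p \<beta> f"
    and "0 \<le> K"
  shows "comp_op_norm p \<beta> \<phi> \<le> K"
  unfolding comp_op_norm_def
proof (rule cSup_least)
  show "{lp_norm p \<beta> (fps_poly_compose f \<phi>) | f. f \<in> lp_space p \<beta> \<and> lp_norm p \<beta> f \<le> 1} \<noteq> {}"
    using zero_in_lp_space lp_norm_zero[of p \<beta>] by fastforce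
next
  fix v assume "v \<in> {lp_norm p \<beta> (fps_poly_compose f \<phi>) | f. f \<in> lp_space p \<beta> \<and> lp_norm p \<beta> f \<le> 1}"
  then obtain f where f: "f \<in> lp_space p \<beta>" "lp_norm p \<beta> f \<le> 1"
    and v: "v = lp_norm p \<beta> (fps_poly_compose f \<phi>)" by blast
  have "v \<le> K * lp_norm p \<beta> f" using assms(1)[OF f(1)] v by simp
  also have "\<dots> \<le> K" using f(2) assms(2) by (simp add: mult_left_le)
  finally show "v \<le> K" .
qed

section \<open>The upper bound\<close>

text \<open>The weights are distributed as
  \<open>\<bar>f\<^sub>L \<theta>\<^sub>n\<^sub>L\<bar> \<beta> n = (\<bar>f\<^sub>L\<bar> \<beta> L) (\<bar>\<theta>\<^sub>n\<^sub>L\<bar> \<beta> n / \<beta> L)\<close>, so that Hoelder's inequality bounds each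
  coefficient by the norm of \<open>f\<close> and the norm of a row. Since \<open>B_sum\<close> is the sum of the \<open>p\<close>-th powers
  of the row norms, its finiteness forces each row to have a finite norm.\<close>

lemma lp_norm_fps_poly_compose_le:
  assumes p: "1 \<le> p" and conj: "1 / ennreal p + 1 / q = 1"
    and \<beta>: "\<And>n. 0 < \<beta> n" and fin: "B_sum d \<alpha> \<beta> p q < \<infinity>" and f: "f \<in> lp_space p \<beta>"
  shows "fps_poly_composable f (symbol_poly d \<alpha>)" (is ?composable)
    and "fps_poly_compose f (symbol_poly d \<alpha>) \<in> lp_space p \<beta>" (is ?mem)
    and "lp_norm p \<beta> (fps_poly_compose f (symbol_poly d \<alpha>))
           \<le> enn2real (B_sum d \<alpha> \<beta> p q) powr (1 / p) * lp_norm p \<beta> f" (is ?le)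
proof -
  let ?\<phi> = "symbol_poly d \<alpha>"
  define a where "a = (\<lambda>L. cmod (fps_nth f L) * \<beta> L)"
  define x where "x = (\<lambda>n L. \<bar>theta d \<alpha> n L\<bar> * \<beta> n / \<beta> L)"
  define A where "A = (\<Sum>L. a L powr p)"
  define b where "b = (\<lambda>n. enn2real (lq_sum_powr p q (x n)))"
  have B: "B_sum d \<alpha> \<beta> p q = (\<Sum>n. lq_sum_powr p q (x n))"
    by (simp add: B_sum_def x_def)
  have row: "lq_sum_powr p q (x n) < \<infinity>" for n
    using fin unfolding B infinity_ennreal_def by (rule ennreal_suminf_lessD)
  have b_eq: "ennreal (b n) = lq_sum_powr p q (x n)" for n
    using row[of n] by (simp add: b_def)
  have b_sum: "summable b"
  proof (rule summable_suminf_not_top)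
    show "(\<Sum>n. ennreal (b n)) \<noteq> top" using fin by (simp add: b_eq B)
  qed (simp add: b_def)
  have b_suminf: "(\<Sum>n. b n) = enn2real (B_sum d \<alpha> \<beta> p q)"
  proof -
    have b_nonneg: "0 \<le> b n" for n by (simp add: b_def)
    have "B_sum d \<alpha> \<beta> p q = ennreal (\<Sum>n. b n)"
      unfolding B b_eq[symmetric] by (rule suminf_ennreal2[OF b_nonneg b_sum])
    thus ?thesis using suminf_nonneg[OF b_sum b_nonneg] by simp
  qed
  have nonneg: "0 \<le> a L" "0 \<le> x n L" for n L
    using \<beta> by (simp_all add: a_def x_def less_imp_le)
  have a_powr: "a L powr p = cmod (fps_nth f L) powr p * \<beta> L powr p" for L
    using \<beta>[of L] by (simp add: a_def powr_mult)
  have a_sum: "summable (\<lambda>L. a L powr p)"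
    using f by (simp add: a_powr lp_space_def)
  have "A \<ge> 0" unfolding A_def using a_sum by (intro suminf_nonneg) auto
  note holder = holder_lq_sum_powr[OF p conj nonneg(1) nonneg(2) a_sum row, folded A_def]
  have ax: "a L * x n L = cmod (fps_nth f L * coeff (?\<phi> ^ L) n) * \<beta> n" for n L
    using \<beta>[of L] by (simp add: a_def x_def coeff_symbol_poly_power norm_mult)
  have abs: "summable (\<lambda>L. cmod (fps_nth f L * coeff (?\<phi> ^ L) n))" for n
  proof -
    have "summable (\<lambda>L. cmod (fps_nth f L * coeff (?\<phi> ^ L) n) * \<beta> n)"
      using holder(1)[of n] by (simp only: ax)
    from summable_mult2[OF this, of "1 / \<beta> n"] show ?thesis using \<beta>[of n] by simp
  qed
  show ?composable
    unfolding fps_poly_composable_def using summable_norm_cancel[OF abs] by simp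
  let ?g = "fps_poly_compose f ?\<phi>"
  have coeff_le: "cmod (fps_nth ?g n) powr p * \<beta> n powr p \<le> A * b n" for n
  proof -
    have "cmod (fps_nth ?g n) * \<beta> n \<le> (\<Sum>L. cmod (fps_nth f L * coeff (?\<phi> ^ L) n)) * \<beta> n"
      using summable_norm[OF abs[of n]] \<beta>[of n] by (simp add: fps_poly_compose_def)
    also have "\<dots> = (\<Sum>L. a L * x n L)"
      by (simp only: ax suminf_mult2[OF abs])
    finally have "(cmod (fps_nth ?g n) * \<beta> n) powr p \<le> (\<Sum>L. a L * x n L) powr p"
      using p \<beta>[of n] by (intro powr_mono2) auto
    also have "\<dots> \<le> A * b n" using holder(2)[of n] by (simp add: b_def)
    finally show ?thesis using \<beta>[of n] by (simp add: powr_mult)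
  qed
  have g_sum: "summable (\<lambda>n. cmod (fps_nth ?g n) powr p * \<beta> n powr p)"
    using coeff_le by (intro summable_comparison_test'[OF summable_mult[OF b_sum, of A], of 0]) auto
  thus ?mem by (simp add: lp_space_def)
  have "(\<Sum>n. cmod (fps_nth ?g n) powr p * \<beta> n powr p) \<le> A * enn2real (B_sum d \<alpha> \<beta> p q)"
    using suminf_le[OF coeff_le g_sum summable_mult[OF b_sum]] suminf_mult[OF b_sum] b_suminf by simp
  hence "lp_norm p \<beta> ?g \<le> (A * enn2real (B_sum d \<alpha> \<beta> p q)) powr (1 / p)"
    unfolding lp_norm_def using p g_sum by (intro powr_mono2 suminf_nonneg) auto
  also have "\<dots> = enn2real (B_sum d \<alpha> \<beta> p q) powr (1 / p) * lp_norm p \<beta> f"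
    using \<open>A \<ge> 0\<close> by (simp add: powr_mult lp_norm_def A_def a_powr)
  finally show ?le .
qed

section \<open>The lower bound\<close>

text \<open>The image of the normalised monomial \<open>z\<^sup>n / \<beta> n\<close> is the \<open>n\<close>-th column of the matrix of
  \<open>C\<^sub>\<phi>\<close>, up to the factor \<open>1 / \<beta> n\<close>.\<close>

lemma column_norm_le_comp_op_norm:
  assumes p: "1 \<le> p" and \<beta>: "\<And>n. 0 < \<beta> n" and bounded: "comp_op_bounded p \<beta> (symbol_poly d \<alpha>)"
  shows "ennpowr (\<Sum>L. ennreal (\<bar>theta d \<alpha> L n\<bar> powr p * \<beta> L powr p)) (1 / p) / ennreal (\<beta> n)
           \<le> ennreal (comp_op_norm p \<beta> (symbol_poly d \<alpha>))"
proof -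
  let ?\<phi> = "symbol_poly d \<alpha>"
  define e where "e = Abs_fps (\<lambda>k. if k = n then complex_of_real (1 / \<beta> n) else 0)"
  let ?g = "fps_poly_compose e ?\<phi>"
  have e_term: "(\<lambda>k. cmod (fps_nth e k) powr p * \<beta> k powr p) = (\<lambda>k. if k = n then 1 else 0)"
  proof
    fix k
    have "cmod (1 / complex_of_real (\<beta> n)) = 1 / \<beta> n"
      using \<beta>[of n] by (simp add: norm_divide)
    thus "cmod (fps_nth e k) powr p * \<beta> k powr p = (if k = n then 1 else 0)"
      using \<beta>[of n] p by (simp add: e_def powr_divide)
  qed
  have e: "e \<in> lp_space p \<beta>" "lp_norm p \<beta> e = 1"
    using sums_If_finite_set[of "{n}" "\<lambda>_. 1::real"] sums_unique
    by (auto simp: lp_space_def lp_norm_def e_term sums_iff)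
  have g_nth: "fps_nth ?g L = complex_of_real (theta d \<alpha> L n) / complex_of_real (\<beta> n)" for L
  proof -
    have "(\<lambda>k. fps_nth e k * coeff (?\<phi> ^ k) L) =
        (\<lambda>k. if k = n then complex_of_real (1 / \<beta> n) * coeff (?\<phi> ^ n) L else 0)"
      by (auto simp: e_def fun_eq_iff)
    also have "\<dots> sums (complex_of_real (1 / \<beta> n) * coeff (?\<phi> ^ n) L)"
      by (rule sums_single)
    finally show ?thesis
      by (simp add: fps_poly_compose_def coeff_symbol_poly_power sums_iff)
  qed
  define c where "c = (\<lambda>L. \<bar>theta d \<alpha> L n\<bar> powr p * \<beta> L powr p)"
  have g_term: "cmod (fps_nth ?g L) powr p * \<beta> L powr p = c L / \<beta> n powr p" for L
    using \<beta>[of n] by (simp add: g_nth c_def norm_divide powr_divide)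
  have "?g \<in> lp_space p \<beta>" using bounded e(1) unfolding comp_op_bounded_def by blast
  hence "summable (\<lambda>L. c L / \<beta> n powr p)" by (simp add: lp_space_def g_term)
  from summable_mult2[OF this, of "\<beta> n powr p"] have c: "summable c"
    using \<beta>[of n] by simp
  have c_nonneg: "0 \<le> c L" for L by (simp add: c_def)
  have "lp_norm p \<beta> ?g = (\<Sum>L. c L) powr (1 / p) / \<beta> n"
    using \<beta>[of n] p c c_nonneg
    by (simp add: lp_norm_def g_term suminf_divide powr_divide suminf_nonneg powr_powr)
  moreover have "lp_norm p \<beta> ?g \<le> comp_op_norm p \<beta> ?\<phi>"
    using lp_norm_compose_le_comp_op_norm[OF bounded e(1)] e(2) by simp
  ultimately have "ennreal ((\<Sum>L. c L) powr (1 / p) / \<beta> n) \<le> ennreal (comp_op_norm p \<beta> ?\<phi>)"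
    by (simp add: ennreal_leI)
  moreover have "ennpowr (\<Sum>L. ennreal (c L)) (1 / p) / ennreal (\<beta> n)
      = ennreal ((\<Sum>L. c L) powr (1 / p) / \<beta> n)"
    using c c_nonneg \<beta>[of n]
    by (simp add: suminf_ennreal2 ennpowr_def suminf_nonneg divide_ennreal)
  ultimately show ?thesis by (simp add: c_def)
qed

theorem theorem2p2:
  fixes p :: real and q :: ennreal and \<beta> :: "nat \<Rightarrow> real"
    and d :: nat and \<alpha> :: "nat \<Rightarrow> real" and \<phi> :: "complex poly"
  assumes p: "1 \<le> p"
    and conj_exp: "1 / ennreal p + 1 / q = 1"
    and beta_pos: "\<And>n. 0 < \<beta> n"
    and beta_0: "\<beta> 0 = 1"
    and phi: "\<phi> = symbol_poly d \<alpha>"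
    and standing: "(\<lambda>n. \<beta> (Suc n) / \<beta> n) \<longlonglongrightarrow> 1 \<or> liminf (\<lambda>n. ereal (root n (\<beta> n))) = 1
                   \<Longrightarrow> poly \<phi> ` ball 0 1 \<subseteq> ball 0 1"
  shows "(B_sum d \<alpha> \<beta> p q < \<infinity> \<longrightarrow>
            comp_op_bounded p \<beta> \<phi> \<and>
            ennreal (comp_op_norm p \<beta> \<phi>) \<le> ennpowr (B_sum d \<alpha> \<beta> p q) (1 / p)) \<and>
         (comp_op_bounded p \<beta> \<phi> \<longrightarrow>
            M_sup d \<alpha> \<beta> p < \<infinity> \<and>
            M_sup d \<alpha> \<beta> p \<le> ennreal (comp_op_norm p \<beta> \<phi>))"
proof (intro conjI impI)
  assume fin: "B_sum d \<alpha> \<beta> p q < \<infinity>"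
  note upper = lp_norm_fps_poly_compose_le[OF p conj_exp beta_pos fin, folded phi]
  show "comp_op_bounded p \<beta> \<phi>"
    unfolding comp_op_bounded_def using upper by blast
  have "comp_op_norm p \<beta> \<phi> \<le> enn2real (B_sum d \<alpha> \<beta> p q) powr (1 / p)"
    using upper(3) by (intro comp_op_norm_le) auto
  thus "ennreal (comp_op_norm p \<beta> \<phi>) \<le> ennpowr (B_sum d \<alpha> \<beta> p q) (1 / p)"
    using fin by (auto simp: ennpowr_def intro: ennreal_leI)
next
  assume bounded: "comp_op_bounded p \<beta> \<phi>"
  show le: "M_sup d \<alpha> \<beta> p \<le> ennreal (comp_op_norm p \<beta> \<phi>)"
    unfolding M_sup_def phi
    using column_norm_le_comp_op_norm[OF p beta_pos bounded[unfolded phi]] by (intro SUP_least)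
  show "M_sup d \<alpha> \<beta> p < \<infinity>"
    using le ennreal_less_top by (simp add: le_less_trans)
qed

end
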